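(* Let $y_1,\dots,y_n\in\mathbb{R}$ and let $\hat y_{j,-i}=\hat y_{j,-i}(x_i)\in\mathbb{R}$ for $j=1,\dots,J$, $i=1,\dots,n$. Let $$T=\Big(\sum_{i=1}^n\hat y_{l,-i}\,\hat y_{j,-i}\Big)_{l,j=1}^{J},\qquad c=\Big(\sum_{i=1}^n y_i\hat y_{1,-i},\dots,\sum_{i=1}^n y_i\hat y_{J,-i}\Big)',$$ with $T$ assumed invertible. Then the weights $\hat w=(\hat w_1,\dots,\hat w_J)'$ achieving $$\min_{w\in\mathbb{R}^J}\ \sum_{i=1}^n\Big(y_i-\sum_{j=1}^J w_j\hat y_{j,-i}(x_i)\Big)^2$$ are of the form $$\hat w=T^{-1}c .$$ In addition, if the $J$ predictors are orthonormal, i.e. $\sum_{i=1}^n\hat y_{l,-i}\hat y_{j,-i}$ equals $1$ if $l=j$ and $0$ otherwise, then $T=I$ and the solution becomes $$\hat w_j=\sum_{i=1}^n y_i\hat y_{j,-i},\qquad j=1,\dots,J .$$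
   Context: Here $y_i$ is the observed response at design point $x_i$ and $\hat y_{j,-i}(x_i)$ is the prediction at $x_i$ from the $j$-th of $J$ predictors fitted without the $i$-th data point; for the statement these are arbitrary given real numbers. No constraints are imposed on the weights. *)

theory Defs
  imports "HOL-Analysis.Analysis"
begin

text \<open>
  The finite index type of the \<open>J\<close> predictors is \<open>'j\<close>, so \<open>J = CARD('j)\<close>; the data points are
  indexed by \<open>{1..n}\<close>. The value \<open>yhat j i\<close> is the leave-one-out prediction of the response
  \<open>y i\<close> by the \<open>j\<close>-th predictor fitted without the \<open>i\<close>-th data point.
\<close>

definition stack_T :: "nat \<Rightarrow> ('j::finite \<Rightarrow> nat \<Rightarrow> real) \<Rightarrow> real^'j^'j" where
  "stack_T n yhat = (\<chi> l j. \<Sum>i=1..n. yhat l i * yhat j i)"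

definition stack_c :: "nat \<Rightarrow> (nat \<Rightarrow> real) \<Rightarrow> ('j::finite \<Rightarrow> nat \<Rightarrow> real) \<Rightarrow> real^'j" where
  "stack_c n y yhat = (\<chi> j. \<Sum>i=1..n. y i * yhat j i)"

definition stack_loss ::
    "nat \<Rightarrow> (nat \<Rightarrow> real) \<Rightarrow> ('j::finite \<Rightarrow> nat \<Rightarrow> real) \<Rightarrow> real^'j \<Rightarrow> real" where
  "stack_loss n y yhat w = (\<Sum>i=1..n. (y i - (\<Sum>j\<in>UNIV. w $ j * yhat j i))\<^sup>2)"

definition orthonormal_predictors :: "nat \<Rightarrow> ('j::finite \<Rightarrow> nat \<Rightarrow> real) \<Rightarrow> bool" where
  "orthonormal_predictors n yhat \<longleftrightarrow>
     (\<forall>l j. (\<Sum>i=1..n. yhat l i * yhat j i) = (if l = j then 1 else 0))"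

end

theory Submission
  imports Defs
begin

text \<open>
  The equation \<open>T w\<^sub>0 = c\<close> says that the residuals at \<open>w\<^sub>0\<close> are orthogonal to every predictor.
  By Pythagoras the loss at \<open>w\<close> therefore exceeds the loss at \<open>w\<^sub>0\<close> by the squared norm of the
  prediction with weights \<open>w - w\<^sub>0\<close>; if that vanishes then \<open>T (w - w\<^sub>0) = 0\<close>, so
  \<open>w = w\<^sub>0\<close> by invertibility.
\<close>

definition stack_pred :: "('j::finite \<Rightarrow> nat \<Rightarrow> real) \<Rightarrow> real^'j \<Rightarrow> nat \<Rightarrow> real" where
  "stack_pred yhat w i = (\<Sum>j\<in>UNIV. w $ j * yhat j i)"

lemma stack_pred_diff:
  "stack_pred yhat (v - w) i = stack_pred yhat v i - stack_pred yhat w i"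
  by (simp add: stack_pred_def algebra_simps sum_subtractf)

text \<open>\<open>stack_T\<close> is the Gram matrix of the predictors, so swapping the two finite
  sums turns each entry of the product into an inner product with the combined prediction.\<close>

lemma stack_T_mult_nth:
  "(stack_T n yhat *v w) $ l = (\<Sum>i=1..n. yhat l i * stack_pred yhat w i)"
proof -
  have "(stack_T n yhat *v w) $ l = (\<Sum>j\<in>UNIV. \<Sum>i=1..n. yhat l i * (w $ j * yhat j i))"
    by (simp add: stack_T_def matrix_vector_mult_def sum_distrib_left mult_ac)
  also have "\<dots> = (\<Sum>i=1..n. \<Sum>j\<in>UNIV. yhat l i * (w $ j * yhat j i))"
    by (rule sum.swap)
  finally show ?thesis
    by (simp add: stack_pred_def sum_distrib_left)
qed

lemma residual_orthogonal_stack_pred: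
  assumes "stack_T n yhat *v w = stack_c n y yhat"
  shows "(\<Sum>i=1..n. (y i - stack_pred yhat w i) * stack_pred yhat d i) = 0"
proof -
  \<comment> \<open>Component \<open>j\<close> of the normal equations; linearity then extends the
    orthogonality from single predictors to the combination with weights \<open>d\<close>.\<close>
  have normal: "(\<Sum>i=1..n. (y i - stack_pred yhat w i) * yhat j i) = 0" for j
    using arg_cong[OF assms, of "\<lambda>v. v $ j"] unfolding stack_T_mult_nth
    by (simp add: stack_c_def right_diff_distrib sum_subtractf mult.commute)
  have "(\<Sum>i=1..n. (y i - stack_pred yhat w i) * stack_pred yhat d i)
      = (\<Sum>i=1..n. \<Sum>j\<in>UNIV. d $ j * ((y i - stack_pred yhat w i) * yhat j i))"
    by (simp add: stack_pred_def[of _ d] sum_distrib_left mult_ac)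
  also have "\<dots> = (\<Sum>j\<in>UNIV. \<Sum>i=1..n. d $ j * ((y i - stack_pred yhat w i) * yhat j i))"
    by (rule sum.swap)
  also have "\<dots> = 0"
    by (simp only: sum_distrib_left[symmetric] normal) simp
  finally show ?thesis .
qed

lemma stack_loss_eq_add_sum_squares:
  assumes "stack_T n yhat *v w0 = stack_c n y yhat"
  shows "stack_loss n y yhat w
    = stack_loss n y yhat w0 + (\<Sum>i=1..n. (stack_pred yhat (w - w0) i)\<^sup>2)"
proof -
  \<comment> \<open>The residual at \<open>w\<close> is the residual at \<open>w0\<close> minus the
    prediction with weights \<open>w - w0\<close>. Expanding the square leaves a cross term that
    sums to zero by orthogonality.\<close>
  have "stack_loss n y yhat w
      = (\<Sum>i=1..n. (y i - stack_pred yhat w0 i)\<^sup>2 + (stack_pred yhat (w - w0) i)\<^sup>2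
          - 2 * ((y i - stack_pred yhat w0 i) * stack_pred yhat (w - w0) i))"
    unfolding stack_loss_def stack_pred_def[symmetric] stack_pred_diff
    by (intro sum.cong) (auto simp: power2_eq_square algebra_simps)
  also have "\<dots> = (\<Sum>i=1..n. (y i - stack_pred yhat w0 i)\<^sup>2)
      + (\<Sum>i=1..n. (stack_pred yhat (w - w0) i)\<^sup>2)"
    by (simp add: sum.distrib sum_subtractf sum_distrib_left[symmetric]
        residual_orthogonal_stack_pred[OF assms, simplified])
  finally show ?thesis
    by (simp add: stack_loss_def stack_pred_def)
qed

text \<open>\<open>matrix_inv\<close> is a Hilbert choice of a two-sided inverse; invertibility says
  that one exists, so the chosen matrix is one.\<close>

lemma matrix_mult_matrix_inv:
  fixes A :: "'a::semiring_1^'n^'m"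
  assumes "invertible A"
  shows "A ** matrix_inv A = mat 1"
  using someI_ex[OF assms[unfolded invertible_def]] by (simp add: matrix_inv_def)

text \<open>Taking any solution \<open>w0\<close> of the normal equations lets the same result serve
  for both closed forms of the weights.\<close>

lemma is_arg_min_stack_loss_iff:
  assumes inv: "invertible (stack_T n yhat)"
    and w0: "stack_T n yhat *v w0 = stack_c n y yhat"
  shows "is_arg_min (stack_loss n y yhat) (\<lambda>_. True) w \<longleftrightarrow> w = w0"
proof
  assume "is_arg_min (stack_loss n y yhat) (\<lambda>_. True) w"
  then have "stack_loss n y yhat w \<le> stack_loss n y yhat w0"
    by (simp add: is_arg_min_linorder)
  then have "(\<Sum>i=1..n. (stack_pred yhat (w - w0) i)\<^sup>2) \<le> 0"
    by (simp add: stack_loss_eq_add_sum_squares[OF w0, of w])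
  then have "(\<Sum>i=1..n. (stack_pred yhat (w - w0) i)\<^sup>2) = 0"
    by (intro antisym sum_nonneg) auto
  then have "\<forall>i\<in>{1..n}. stack_pred yhat (w - w0) i = 0"
    by (simp add: sum_nonneg_eq_0_iff)
  \<comment> \<open>Each entry is an inner product with a prediction that vanishes at all data
    points.\<close>
  then have "stack_T n yhat *v (w - w0) = 0"
    by (simp add: vec_eq_iff stack_T_mult_nth)
  moreover have "inj ((*v) (stack_T n yhat))"
    using inv by (rule inj_matrix_vector_mult)
  ultimately have "w - w0 = 0"
    by (metis injD matrix_vector_mult_0_right)
  then show "w = w0"
    by simp
next
  assume "w = w0"
  moreover have "stack_loss n y yhat w0 \<le> stack_loss n y yhat v" for v
    unfolding stack_loss_eq_add_sum_squares[OF w0, of v] by (simp add: sum_nonneg)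
  ultimately show "is_arg_min (stack_loss n y yhat) (\<lambda>_. True) w"
    by (simp add: is_arg_min_linorder)
qed

theorem theorem3p2:
  fixes n :: nat
    and y :: "nat \<Rightarrow> real"
    and yhat :: "'j::finite \<Rightarrow> nat \<Rightarrow> real"
  assumes "invertible (stack_T n yhat)"
  shows "(\<forall>w. is_arg_min (stack_loss n y yhat) (\<lambda>_. True) w \<longleftrightarrow>
            w = matrix_inv (stack_T n yhat) *v stack_c n y yhat) \<and>
         (orthonormal_predictors n yhat \<longrightarrow>
            stack_T n yhat = mat 1 \<and>
            (\<forall>w. is_arg_min (stack_loss n y yhat) (\<lambda>_. True) w \<longleftrightarrow>
               (\<forall>j. w $ j = (\<Sum>i=1..n. y i * yhat j i))))"
proof (intro conjI impI allI)
  fix w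
  have "stack_T n yhat *v (matrix_inv (stack_T n yhat) *v stack_c n y yhat) = stack_c n y yhat"
    using assms by (simp add: matrix_vector_mul_assoc matrix_mult_matrix_inv)
  then show "is_arg_min (stack_loss n y yhat) (\<lambda>_. True) w \<longleftrightarrow>
      w = matrix_inv (stack_T n yhat) *v stack_c n y yhat"
    by (rule is_arg_min_stack_loss_iff[OF assms])
next
  assume "orthonormal_predictors n yhat"
  then show T: "stack_T n yhat = mat 1"
    by (simp add: orthonormal_predictors_def stack_T_def mat_def)
  fix w
  \<comment> \<open>With the identity as Gram matrix, \<open>stack_c\<close> itself solves the
    normal equations and can take the role of \<open>w0\<close>.\<close>
  have "stack_T n yhat *v stack_c n y yhat = stack_c n y yhat"
    by (simp add: T)
  then have "is_arg_min (stack_loss n y yhat) (\<lambda>_. True) w \<longleftrightarrow> w = stack_c n y yhat"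
    by (rule is_arg_min_stack_loss_iff[OF assms])
  then show "is_arg_min (stack_loss n y yhat) (\<lambda>_. True) w \<longleftrightarrow>
      (\<forall>j. w $ j = (\<Sum>i=1..n. y i * yhat j i))"
    by (simp add: vec_eq_iff stack_c_def)
qed

end
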